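(* Let $\lambda\colon\mathbb H\to\mathrm{Mat}_{2\times2}(\mathbb C)$ be the $\mathbb R$-algebra embedding of the quaternions given in the context and let $\mathbb H_1$ be the group of quaternions of norm $1$. The set $\lambda(\mathbb H_1)\cup\lambda(\mathbb H_1)i\subset\mathrm{Mat}_{2\times2}(\mathbb C)$ forms a group under multiplication, namely the unimodular unitary group $$\mathrm U(2)^{\pm1}=\{A\in\mathrm{GL}(2,\mathbb C)\mid A\cdot\overline A^{T}=\mathbf 1,\ \det A=\pm1\}\leqslant\mathrm U(2)$$ of unitary $2\times2$ matrices of determinant $\pm1$.
   Context: $\mathbb H=\mathbb R1\oplus\mathbb R\mathbf i\oplus\mathbb R\mathbf j\oplus\mathbb R\mathbf k$ is the real quaternion algebra, with norm $N(\alpha1+\beta\mathbf i+\gamma\mathbf j+\delta\mathbf k)=\alpha^2+\beta^2+\gamma^2+\delta^2$, and $\mathbb H_1=\{x\in\mathbb H\mid N(x)=1\}$. The embedding is $$\lambda(\alpha1+\beta\mathbf i+\gamma\mathbf j+\delta\mathbf k)=\begin{pmatrix}\alpha+\beta i&-\gamma-\delta i\\ \gamma-\delta i&\alpha-\beta i\end{pmatrix}.$$ $\lambda(\mathbb H_1)i$ denotes the set of matrices $\lambda(x)\cdot i$, $x\in\mathbb H_1$, where $i\in\mathbb C$ is the imaginary unit acting as a scalar. *)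

theory Defs
  imports "HOL-Analysis.Analysis" "HOL-Algebra.Group"
begin

text \<open>\<^term>\<open>Quat a b c d\<close> stands for a1 + bi + cj + dk.\<close>

datatype quat = Quat (q1: real) (qi: real) (qj: real) (qk: real)

instantiation quat :: real_algebra_1
begin

definition zero_quat :: quat where "0 = Quat 0 0 0 0"
definition one_quat :: quat where "1 = Quat 1 0 0 0"
definition plus_quat :: "quat \<Rightarrow> quat \<Rightarrow> quat" where
  "x + y = Quat (q1 x + q1 y) (qi x + qi y) (qj x + qj y) (qk x + qk y)"
definition uminus_quat :: "quat \<Rightarrow> quat" where
  "- x = Quat (- q1 x) (- qi x) (- qj x) (- qk x)"
definition minus_quat :: "quat \<Rightarrow> quat \<Rightarrow> quat" where
  "x - y = Quat (q1 x - q1 y) (qi x - qi y) (qj x - qj y) (qk x - qk y)"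
definition scaleR_quat :: "real \<Rightarrow> quat \<Rightarrow> quat" where
  "r *\<^sub>R x = Quat (r * q1 x) (r * qi x) (r * qj x) (r * qk x)"
definition times_quat :: "quat \<Rightarrow> quat \<Rightarrow> quat" where
  "x * y = Quat
     (q1 x * q1 y - qi x * qi y - qj x * qj y - qk x * qk y)
     (q1 x * qi y + qi x * q1 y + qj x * qk y - qk x * qj y)
     (q1 x * qj y - qi x * qk y + qj x * q1 y + qk x * qi y)
     (q1 x * qk y + qi x * qj y - qj x * qi y + qk x * q1 y)"

instance
  by standard
    (simp_all add: zero_quat_def one_quat_def plus_quat_def uminus_quat_def minus_quat_def
      scaleR_quat_def times_quat_def algebra_simps quat.expand)

end

lemmas quat_defs = zero_quat_def one_quat_def plus_quat_def uminus_quat_def minus_quat_def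
  scaleR_quat_def times_quat_def

definition quat_i :: quat where "quat_i = Quat 0 1 0 0"
definition quat_j :: quat where "quat_j = Quat 0 0 1 0"
definition quat_k :: quat where "quat_k = Quat 0 0 0 1"

lemma Quat_eq_combination:
  "Quat a b c d = a *\<^sub>R 1 + b *\<^sub>R quat_i + c *\<^sub>R quat_j + d *\<^sub>R quat_k"
  by (simp add: quat_defs quat_i_def quat_j_def quat_k_def)

lemma quat_unit_products:
  "quat_i * quat_i = -1" "quat_j * quat_j = -1" "quat_k * quat_k = -1"
  "quat_i * quat_j = quat_k" "quat_j * quat_k = quat_i" "quat_k * quat_i = quat_j"
  "quat_j * quat_i = - quat_k" "quat_k * quat_j = - quat_i" "quat_i * quat_k = - quat_j"
  by (simp_all add: quat_defs quat_i_def quat_j_def quat_k_def)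

text \<open>The norm N is the reduced norm, i.e. the square of the Euclidean length.\<close>

definition quat_N :: "quat \<Rightarrow> real" where
  "quat_N x = (q1 x)\<^sup>2 + (qi x)\<^sup>2 + (qj x)\<^sup>2 + (qk x)\<^sup>2"

definition quat_H1 :: "quat set" where
  "quat_H1 = {x. quat_N x = 1}"

lemma quat_N_mult: "quat_N (x * y) = quat_N x * quat_N y"
  by (simp add: quat_N_def times_quat_def power2_eq_square algebra_simps)

lemma group_quat_H1: "group \<lparr>carrier = quat_H1, mult = (*), one = (1::quat)\<rparr>"
proof (rule groupI, simp_all add: mult.assoc)
  show "x * y \<in> quat_H1" if "x \<in> quat_H1" "y \<in> quat_H1" for x y
    using that by (simp add: quat_H1_def quat_N_mult)
  show "1 \<in> quat_H1" by (simp add: quat_H1_def quat_N_def one_quat_def)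
  show "\<exists>y\<in>quat_H1. y * x = 1" if "x \<in> quat_H1" for x
    by (rule bexI[of _ "Quat (q1 x) (- qi x) (- qj x) (- qk x)"])
      (use that in \<open>simp_all add: quat_H1_def quat_N_def quat_defs power2_eq_square algebra_simps\<close>)
qed

definition quat_lambda :: "quat \<Rightarrow> complex^2^2" where
  "quat_lambda x = vector
     [vector [of_real (q1 x) + of_real (qi x) * \<i>, - of_real (qj x) - of_real (qk x) * \<i>],
      vector [of_real (qj x) - of_real (qk x) * \<i>, of_real (q1 x) - of_real (qi x) * \<i>]]"

lemma quat_lambda_algebra_embedding:
  "quat_lambda (x + y) = quat_lambda x + quat_lambda y"
  "quat_lambda (r *\<^sub>R x) = r *\<^sub>R quat_lambda x"
  "quat_lambda (x * y) = quat_lambda x ** quat_lambda y"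
  "quat_lambda 1 = mat 1"
  "inj quat_lambda"
proof -
  show "inj quat_lambda"
    by (rule injI) (auto simp: quat_lambda_def vec_eq_iff forall_2 complex_eq_iff quat.expand)
qed (simp_all add: quat_lambda_def vec_eq_iff forall_2 quat_defs matrix_matrix_mult_def sum_2
      mat_def complex_eq_iff algebra_simps)

definition conj_transpose :: "complex^'n^'m \<Rightarrow> complex^'m^'n" where
  "conj_transpose A = transpose (map_matrix cnj A)"

definition GL2 :: "(complex^2^2) monoid" where
  "GL2 = \<lparr>carrier = {A. invertible A}, mult = (**), one = mat 1\<rparr>"

definition U2_set :: "(complex^2^2) set" where
  "U2_set = {A \<in> carrier GL2. A ** conj_transpose A = mat 1}"

definition U2 :: "(complex^2^2) monoid" where
  "U2 = GL2\<lparr>carrier := U2_set\<rparr>"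

definition U2_pm1 :: "(complex^2^2) set" where
  "U2_pm1 = {A \<in> carrier GL2. A ** conj_transpose A = mat 1 \<and> (det A = 1 \<or> det A = -1)}"

lemma group_GL2: "group GL2"
proof (rule groupI, simp_all add: GL2_def matrix_mul_assoc invertible_mult)
  show "invertible (mat 1 :: complex^2^2)" by (auto simp: invertible_def)
  show "\<exists>B. invertible B \<and> B ** A = mat 1" if "invertible A" for A :: "complex^2^2"
    using that by (auto simp: invertible_def)
qed

lemma conj_transpose_mult:
  "conj_transpose (A ** B) = conj_transpose B ** conj_transpose A"
  by (simp add: conj_transpose_def vec_eq_iff transpose_def map_matrix_def
      matrix_matrix_mult_def mult.commute)

lemma subgroup_U2: "subgroup U2_set GL2"
proof (rule group.subgroupI[OF group_GL2])
  interpret GL2: group GL2 by (rule group_GL2)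
  show "U2_set \<subseteq> carrier GL2" by (auto simp: U2_set_def)
  have "mat 1 \<in> U2_set"
    using monoid.one_closed[OF group.is_monoid[OF group_GL2]]
    by (simp add: U2_set_def GL2_def conj_transpose_def vec_eq_iff transpose_def
        map_matrix_def mat_def forall_2 matrix_matrix_mult_def sum_2)
  then show "U2_set \<noteq> {}" by blast
  show "A \<otimes>\<^bsub>GL2\<^esub> B \<in> U2_set" if "A \<in> U2_set" "B \<in> U2_set" for A B
  proof -
    have "(A ** B) ** conj_transpose (A ** B) = A ** (B ** conj_transpose B) ** conj_transpose A"
      by (simp add: conj_transpose_mult matrix_mul_assoc)
    then show ?thesis using that
      by (auto simp: U2_set_def GL2_def invertible_mult)
  qed
  show "inv\<^bsub>GL2\<^esub> A \<in> U2_set" if "A \<in> U2_set" for A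
  proof -
    let ?B = "conj_transpose A"
    have A: "A \<in> carrier GL2" "A ** ?B = mat 1" using that by (auto simp: U2_set_def)
    then have BA: "?B ** A = mat 1" by (simp add: matrix_left_right_inverse)
    have B: "?B \<in> carrier GL2" using A BA by (auto simp: GL2_def invertible_def)
    have "inv\<^bsub>GL2\<^esub> A = ?B"
      using A B BA by (intro GL2.inv_equality) (auto simp: GL2_def)
    moreover have "conj_transpose ?B = A"
      by (simp add: conj_transpose_def vec_eq_iff transpose_def map_matrix_def)
    ultimately show ?thesis using B BA by (simp add: U2_set_def)
  qed
qed

lemma group_U2: "group U2"
  unfolding U2_def using group.subgroup_imp_group[OF group_GL2 subgroup_U2] .

definition lambda_H1 :: "(complex^2^2) set" where
  "lambda_H1 = quat_lambda ` quat_H1"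

definition lambda_H1_i :: "(complex^2^2) set" where
  "lambda_H1_i = map_matrix (\<lambda>z. z * \<i>) ` lambda_H1"

end

theory Submission
  imports Defs
begin

text \<open>If \<open>A\<close> is unitary of determinant \<open>1\<close>, then its conjugate transpose is its adjugate, and this
  says precisely that \<open>A\<close> has the shape of \<open>\<lambda>(x)\<close>, with the norm of \<open>x\<close> equal to \<open>det A = 1\<close>.
  Multiplication by the scalar \<open>i\<close> preserves unitarity and negates the determinant of a \<open>2\<times>2\<close>
  matrix, so it exchanges the unitary matrices of determinant \<open>1\<close> and \<open>-1\<close>.\<close>

text \<open>Entry (i, j) of the product is the Hermitian product of rows i and j. This turns
  unitarity into polynomial equations in the entries and their conjugates.\<close>

lemma unitary_2_iff:
  fixes A :: "complex^2^2"
  shows "A ** conj_transpose A = mat 1 \<longleftrightarrow>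
    A$1$1 * cnj (A$1$1) + A$1$2 * cnj (A$1$2) = 1 \<and>
    A$1$1 * cnj (A$2$1) + A$1$2 * cnj (A$2$2) = 0 \<and>
    A$2$1 * cnj (A$1$1) + A$2$2 * cnj (A$1$2) = 0 \<and>
    A$2$1 * cnj (A$2$1) + A$2$2 * cnj (A$2$2) = 1"
  by (simp add: vec_eq_iff forall_2 matrix_matrix_mult_def sum_2 conj_transpose_def
      transpose_def map_matrix_def mat_def)

lemma det_quat_lambda: "det (quat_lambda x) = of_real (quat_N x)"
  by (simp add: det_2 quat_lambda_def quat_N_def complex_eq_iff power2_eq_square)

lemma quat_lambda_unitary:
  assumes "quat_N x = 1"
  shows "quat_lambda x ** conj_transpose (quat_lambda x) = mat 1"
  using assms
  by (simp add: unitary_2_iff quat_lambda_def quat_N_def complex_eq_iff power2_eq_square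
      algebra_simps)

lemma special_unitary_2_entries:
  fixes A :: "complex^2^2"
  assumes "A ** conj_transpose A = mat 1" and "det A = 1"
  shows "A$2$2 = cnj (A$1$1)" and "A$2$1 = - cnj (A$1$2)"
proof -
  define a b c d where "a = A$1$1" "b = A$1$2" "c = A$2$1" "d = A$2$2"
  have row: "a * cnj a + b * cnj b = 1" and orth: "c * cnj a + d * cnj b = 0"
    using assms(1) by (simp_all add: unitary_2_iff a_b_c_d_def)
  have det: "a * d - b * c = 1"
    using assms(2) by (simp add: det_2 a_b_c_d_def)
  \<comment> \<open>Multiply \<open>row\<close> by \<open>d\<close> and replace
    \<open>d * cnj b\<close> by \<open>- c * cnj a\<close>, using \<open>orth\<close>: this gives
    \<open>d = cnj a * (a * d - b * c)\<close>, and the last factor is 1 by \<open>det\<close>.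
    Multiplying \<open>row\<close> by \<open>c\<close> gives the formula for \<open>c\<close> in the
    same way.\<close>
  have "d = cnj a" using row orth det by algebra
  then show "A$2$2 = cnj (A$1$1)" by (simp add: a_b_c_d_def)
  have "c = - cnj b" using row orth det by algebra
  then show "A$2$1 = - cnj (A$1$2)" by (simp add: a_b_c_d_def)
qed

lemma lambda_H1_eq_special_unitary:
  "lambda_H1 = {A. A ** conj_transpose A = mat 1 \<and> det A = 1}"
proof (intro equalityI subsetI)
  fix A assume "A \<in> lambda_H1"
  then show "A \<in> {A. A ** conj_transpose A = mat 1 \<and> det A = 1}"
    by (auto simp: lambda_H1_def quat_H1_def quat_lambda_unitary det_quat_lambda)
next
  fix A :: "complex^2^2"
  assume "A \<in> {A. A ** conj_transpose A = mat 1 \<and> det A = 1}"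
  then have unitary: "A ** conj_transpose A = mat 1" and det: "det A = 1" by auto
  \<comment> \<open>The coordinates are read off the first row of \<open>quat_lambda\<close>, whose
    second entry carries the minus signs; the second row of \<open>A\<close> is then forced.\<close>
  define x where "x = Quat (Re (A$1$1)) (Im (A$1$1)) (- Re (A$1$2)) (- Im (A$1$2))"
  have A: "A = quat_lambda x"
    using special_unitary_2_entries[OF unitary det]
    by (simp add: x_def quat_lambda_def vec_eq_iff forall_2 complex_eq_iff)
  have "complex_of_real (quat_N x) = 1"
    using det by (simp add: A det_quat_lambda)
  then show "A \<in> lambda_H1"
    by (auto simp: A lambda_H1_def quat_H1_def)
qed

text \<open>Each Hermitian product of rows acquires the factor \<open>c * cnj c = 1\<close>. A
  general \<open>c\<close> covers both \<open>\<i>\<close> and its inverse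
  \<open>- \<i>\<close>.\<close>

lemma unitary_map_matrix_mult:
  fixes A :: "complex^2^2"
  assumes "c * cnj c = 1" and "A ** conj_transpose A = mat 1"
  shows "map_matrix (\<lambda>z. z * c) A ** conj_transpose (map_matrix (\<lambda>z. z * c) A) = mat 1"
proof -
  have cancel: "z * c * (cnj w * cnj c) = z * cnj w" for z w
    using assms(1) by algebra
  show ?thesis
    using assms(2) by (simp add: unitary_2_iff map_matrix_def cancel)
qed

lemma det_map_matrix_mult:
  fixes A :: "complex^2^2"
  shows "det (map_matrix (\<lambda>z. z * c) A) = c\<^sup>2 * det A"
  by (simp add: det_2 map_matrix_def power2_eq_square algebra_simps)

lemma lambda_H1_i_eq_unitary_det_minus_one:
  "lambda_H1_i = {A. A ** conj_transpose A = mat 1 \<and> det A = -1}"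
proof (intro equalityI subsetI)
  fix A assume "A \<in> lambda_H1_i"
  then show "A \<in> {A. A ** conj_transpose A = mat 1 \<and> det A = -1}"
    by (auto simp: lambda_H1_i_def lambda_H1_eq_special_unitary unitary_map_matrix_mult
        det_map_matrix_mult)
next
  fix A :: "complex^2^2"
  assume A: "A \<in> {A. A ** conj_transpose A = mat 1 \<and> det A = -1}"
  \<comment> \<open>Scaling by \<open>- \<i>\<close> undoes scaling by \<open>\<i>\<close>, and its
    square -1 turns determinant -1 into 1.\<close>
  define B where "B = map_matrix (\<lambda>z. z * - \<i>) A"
  have "B \<in> lambda_H1"
    using A unitary_map_matrix_mult[of "- \<i>" A] det_map_matrix_mult[of "- \<i>" A]
    by (simp add: B_def lambda_H1_eq_special_unitary)
  moreover have "A = map_matrix (\<lambda>z. z * \<i>) B"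
    by (simp add: B_def map_matrix_def vec_eq_iff mult.assoc)
  ultimately show "A \<in> lambda_H1_i"
    by (auto simp: lambda_H1_i_def)
qed

lemma lambda_H1_Un_lambda_H1_i: "lambda_H1 \<union> lambda_H1_i = U2_pm1"
proof -
  \<comment> \<open>A right inverse of a square matrix is also a left inverse, which gives the
    membership in \<open>GL2\<close> required by \<open>U2_pm1\<close>.\<close>
  have "invertible A" if "A ** conj_transpose A = mat 1" for A :: "complex^2^2"
    using that matrix_left_right_inverse unfolding invertible_def by blast
  then show ?thesis
    by (auto simp: lambda_H1_eq_special_unitary lambda_H1_i_eq_unitary_det_minus_one
        U2_pm1_def GL2_def)
qed

lemma U2_pm1_eq: "U2_pm1 = {A \<in> carrier U2. det A = 1 \<or> det A = -1}"
  by (auto simp: U2_pm1_def U2_def U2_set_def)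

text \<open>The determinant is multiplicative, and {1, -1} is closed under products and
  inverses.\<close>

lemma subgroup_U2_pm1: "subgroup U2_pm1 U2"
proof -
  interpret U2: group U2 by (rule group_U2)
  have mult: "A \<otimes>\<^bsub>U2\<^esub> B = A ** B" for A B by (simp add: U2_def GL2_def)
  have one: "\<one>\<^bsub>U2\<^esub> = mat 1" by (simp add: U2_def GL2_def)
  show ?thesis
  proof (rule U2.subgroupI)
    show "U2_pm1 \<subseteq> carrier U2" by (auto simp: U2_pm1_eq)
    have "mat 1 \<in> U2_pm1"
      using U2.one_closed by (simp add: U2_pm1_eq one)
    then show "U2_pm1 \<noteq> {}" by blast
  next
    fix A B assume "A \<in> U2_pm1" "B \<in> U2_pm1"
    then show "A \<otimes>\<^bsub>U2\<^esub> B \<in> U2_pm1"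
      using U2.m_closed[of A B] by (auto simp: U2_pm1_eq mult det_mul)
  next
    fix A assume A: "A \<in> U2_pm1"
    then have carrier: "A \<in> carrier U2" by (simp add: U2_pm1_eq)
    then have "det (A ** inv\<^bsub>U2\<^esub> A) = 1"
      using U2.r_inv[of A] by (simp add: mult one)
    then have "det A * det (inv\<^bsub>U2\<^esub> A) = 1" by (simp add: det_mul)
    then have "det (inv\<^bsub>U2\<^esub> A) = 1 \<or> det (inv\<^bsub>U2\<^esub> A) = -1"
      using A by (auto simp: U2_pm1_eq minus_equation_iff)
    then show "inv\<^bsub>U2\<^esub> A \<in> U2_pm1"
      using U2.inv_closed[OF carrier] by (simp add: U2_pm1_eq)
  qed
qed

theorem corollary4p11:
  "group \<lparr>carrier = lambda_H1 \<union> lambda_H1_i, mult = (**), one = mat 1\<rparr>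
   \<and> lambda_H1 \<union> lambda_H1_i = U2_pm1
   \<and> subgroup U2_pm1 U2"
proof -
  \<comment> \<open>Restricting the carrier keeps the product and unit of \<open>GL2\<close>, so the
    group obtained from the subgroup is literally the one claimed.\<close>
  have "U2\<lparr>carrier := U2_pm1\<rparr> = \<lparr>carrier = U2_pm1, mult = (**), one = mat 1\<rparr>"
    by (simp add: U2_def GL2_def)
  then show ?thesis
    using group.subgroup_imp_group[OF group_U2 subgroup_U2_pm1]
    by (simp add: lambda_H1_Un_lambda_H1_i subgroup_U2_pm1)
qed

end
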